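(* Let $\nu>1$ be an integer and let $C=C(\nu)\in\mathbb{R}^{(\nu+6)\times(\nu+6)}$ be the matrix defined as follows, where $u$ ranges over $\{1,\ldots,\nu+1\}$ and $v$ over $\{1,\ldots,\nu+2\}$: (1) $C_{uv}=\min\{10u+10v-10,\,20u+1,\,20v-9\}$ if $(u,v)\notin\{(\nu,\nu+1),(\nu+1,\nu+1)\}$; (2) $C_{\nu,\nu+1}=20\nu-1$ and $C_{\nu+1,\nu+1}=20\nu+11$; (3) $C_{u,\nu+3}=0$ and $C_{u,\nu+4}=C_{u,\nu+5}=C_{u,\nu+6}=2$; (4) $C_{\nu+2,u}=10u-3$, $C_{\nu+3,u}=11$, $C_{\nu+4,u}=C_{\nu+5,u}=2$, $C_{\nu+6,u}=0$; (5) the submatrix of $C$ with rows and columns $\nu+2,\ldots,\nu+6$ equals $$\begin{pmatrix}0&0&0&0&2\\0&0&2&0&2\\2&2&0&2&2\\0&2&2&0&2\\0&2&2&2&0\end{pmatrix}.$$ Let $\mu\in\{1,\ldots,\nu+1\}$. Then the matrix $C'$ obtained from $C(\nu)$ by removing its $\mu$th column has factor rank at most $4$.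
   Context: The tropical semiring is $\mathbb{R}$ with $a\oplus b=\min\{a,b\}$ and $a\otimes b=a+b$; $(B\otimes C)_{ij}=\min_{\tau}\{B_{i\tau}+C_{\tau j}\}$. The factor rank of $A\in\mathbb{R}^{m\times n}$ is the smallest $k$ such that $A=B\otimes C$ for some $B\in\mathbb{R}^{m\times k}$, $C\in\mathbb{R}^{k\times n}$. *)

theory Defs
  imports Complex_Main "Jordan_Normal_Form.Matrix" "Jordan_Normal_Form.DL_Submatrix"
begin

text \<open>Only products with a nonempty inner index range are meaningful: real matrices do not
  contain the tropical zero, and \<open>Min {}\<close> is unspecified.\<close>

definition tropical_mult :: "real mat \<Rightarrow> real mat \<Rightarrow> real mat" (infixl "\<otimes>\<^sub>t" 70) where
  "B \<otimes>\<^sub>t C = mat (dim_row B) (dim_col C)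
     (\<lambda>(i, j). Min ((\<lambda>\<tau>. B $$ (i, \<tau>) + C $$ (\<tau>, j)) ` {..<dim_col B}))"

definition tropical_factorization :: "real mat \<Rightarrow> nat \<Rightarrow> bool" where
  "tropical_factorization A k \<longleftrightarrow>
     (\<exists>B C. B \<in> carrier_mat (dim_row A) k \<and> C \<in> carrier_mat k (dim_col A) \<and> A = B \<otimes>\<^sub>t C)"

definition factor_rank :: "real mat \<Rightarrow> nat" where
  "factor_rank A = (LEAST k. k > 0 \<and> tropical_factorization A k)"

text \<open>The set minimised in \<open>factor_rank\<close> is never empty: multiply \<open>A\<close> by a square matrix with
  zero diagonal and a large constant off the diagonal.\<close>

lemma tropical_factorization_exists: "\<exists>k>0. tropical_factorization A k"
proof (cases "dim_col A = 0")
  case True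
  have "A = mat (dim_row A) 1 (\<lambda>_. 0) \<otimes>\<^sub>t mat 1 (dim_col A) (\<lambda>_. 0)"
    by (rule eq_matI) (auto simp: tropical_mult_def True)
  then have "tropical_factorization A 1"
    unfolding tropical_factorization_def by (intro exI conjI) auto
  then show ?thesis by (intro exI[of _ 1]) simp
next
  case False
  define n where "n = dim_col A"
  define S where "S = (\<lambda>p. \<bar>A $$ p\<bar>) ` ({..<dim_row A} \<times> {..<n})"
  define M where "M = 2 * Max (insert 0 S)"
  have S: "\<bar>A $$ (i, j)\<bar> \<le> Max (insert 0 S)" if "i < dim_row A" "j < n" for i j
    using that by (intro Max_ge) (auto simp: S_def)
  define D where "D = mat n n (\<lambda>(i, j). if i = j then 0 else M)"
  have "A = A \<otimes>\<^sub>t D"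
  proof (rule eq_matI)
    fix i j assume "i < dim_row (A \<otimes>\<^sub>t D)" "j < dim_col (A \<otimes>\<^sub>t D)"
    then have ij: "i < dim_row A" "j < n" by (auto simp: tropical_mult_def D_def)
    have "Min ((\<lambda>\<tau>. A $$ (i, \<tau>) + D $$ (\<tau>, j)) ` {..<dim_col A}) = A $$ (i, j)"
    proof (rule Min_eqI)
      fix y assume "y \<in> (\<lambda>\<tau>. A $$ (i, \<tau>) + D $$ (\<tau>, j)) ` {..<dim_col A}"
      then obtain t where t: "t < n" "y = A $$ (i, t) + D $$ (t, j)" by (auto simp: n_def)
      show "A $$ (i, j) \<le> y"
        using S[OF ij] S[OF ij(1) t(1)] t ij by (auto simp: D_def M_def)
    next
      show "A $$ (i, j) \<in> (\<lambda>\<tau>. A $$ (i, \<tau>) + D $$ (\<tau>, j)) ` {..<dim_col A}"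
        using ij by (intro image_eqI[of _ _ j]) (auto simp: D_def n_def)
    qed simp
    then show "A $$ (i, j) = (A \<otimes>\<^sub>t D) $$ (i, j)"
      using ij by (auto simp: tropical_mult_def D_def)
  qed (auto simp: tropical_mult_def D_def n_def)
  then have "tropical_factorization A n"
    unfolding tropical_factorization_def
    by (intro exI[of _ A] exI[of _ D] conjI) (auto simp: D_def n_def)
  then show ?thesis using False by (auto simp: n_def)
qed

definition C_block :: "real list list" where
  "C_block =
    [[0, 0, 0, 0, 2],
     [0, 0, 2, 0, 2],
     [2, 2, 0, 2, 2],
     [0, 2, 2, 0, 2],
     [0, 2, 2, 2, 0]]"

text \<open>Entries of \<open>C(\<nu>)\<close> with rows and columns numbered from 1 to \<open>\<nu> + 6\<close>; the values outside
  this range are irrelevant.\<close>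

definition C_entry :: "nat \<Rightarrow> nat \<Rightarrow> nat \<Rightarrow> real" where
  "C_entry \<nu> i j =
    (if i \<le> \<nu> + 1 then
       (if j \<le> \<nu> + 2 then
          (if i = \<nu> \<and> j = \<nu> + 1 then 20 * real \<nu> - 1
           else if i = \<nu> + 1 \<and> j = \<nu> + 1 then 20 * real \<nu> + 11
           else min (10 * real i + 10 * real j - 10) (min (20 * real i + 1) (20 * real j - 9)))
        else if j = \<nu> + 3 then 0
        else 2)
     else if j \<le> \<nu> + 1 then
       (if i = \<nu> + 2 then 10 * real j - 3
        else if i = \<nu> + 3 then 11
        else if i = \<nu> + 6 then 0
        else 2)
     else C_block ! (i - (\<nu> + 2)) ! (j - (\<nu> + 2)))"

text \<open>Matrices of type \<open>mat\<close> are indexed from 0.\<close>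

definition C_mat :: "nat \<Rightarrow> real mat" where
  "C_mat \<nu> = mat (\<nu> + 6) (\<nu> + 6) (\<lambda>(i, j). C_entry \<nu> (i + 1) (j + 1))"

text \<open>Here \<open>\<mu>\<close> counts columns from 1.\<close>

definition remove_col :: "nat \<Rightarrow> 'a mat \<Rightarrow> 'a mat" where
  "remove_col \<mu> A = submatrix A UNIV (- {\<mu> - 1})"

end

theory Submission
  imports Defs
begin

text \<open>On the upper left block the terms \<open>10u + 10v - 10\<close>, \<open>20v - 9\<close>, \<open>20u + 1\<close> are tropical
  rank-one matrices, carried by the first, second and fourth of four factors, but the exceptional
  column \<open>\<nu> + 1\<close> prevents an exact fit. Once column \<open>\<mu>\<close> is gone, the first factor may be
  shifted by one unit in opposite directions in the rows \<open>u \<ge> \<mu>\<close> and the columns \<open>v > \<mu>\<close>: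
  the entry \<open>(\<mu>, \<mu>)\<close>, which this would spoil, no longer exists, and the other entries whose
  value in the first factor changes are attained by the second and fourth. The shift makes room
  for the exceptional column, and the entries it spoils in row \<open>\<nu> + 2\<close> are supplied by the third
  factor.\<close>

lemma factor_rank_le:
  assumes "tropical_factorization A k" "k > 0"
  shows "factor_rank A \<le> k"
  unfolding factor_rank_def using assms by (intro Least_le) auto

text \<open>Lets entries be checked in the column numbering of \<open>A\<close>, with nothing asked
  outside \<open>J\<close>; \<open>pick J\<close> does the renumbering.\<close>

lemma tropical_factorization_submatrix_cols:
  assumes "\<And>i j. \<lbrakk>i < dim_row A; j < dim_col A; j \<in> J\<rbrakk> \<Longrightarrow>
    A $$ (i, j) = Min ((\<lambda>\<tau>. f i \<tau> + g \<tau> j) ` {..<k})"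
  shows "tropical_factorization (submatrix A UNIV J) k"
proof -
  define m where "m = card {j. j < dim_col A \<and> j \<in> J}"
  define B where "B = mat (dim_row A) k (\<lambda>(i, \<tau>). f i \<tau>)"
  define C where "C = mat k m (\<lambda>(\<tau>, j). g \<tau> (pick J j))"
  have dims: "dim_row (submatrix A UNIV J) = dim_row A" "dim_col (submatrix A UNIV J) = m"
    by (simp_all add: dim_submatrix m_def)
  have "submatrix A UNIV J = B \<otimes>\<^sub>t C"
  proof (rule eq_matI)
    fix i j assume "i < dim_row (B \<otimes>\<^sub>t C)" "j < dim_col (B \<otimes>\<^sub>t C)"
    then have i: "i < dim_row A" and j: "j < m"
      by (simp_all add: tropical_mult_def B_def C_def)
    have pick_lt: "pick J j < dim_col A"
      using j pick_le unfolding m_def by auto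
    have "pick J j \<in> J"
    proof (cases "infinite J")
      case False
      then have "m \<le> card J"
        unfolding m_def by (intro card_mono) auto
      then show ?thesis using j by (intro pick_in_set_le) auto
    qed (rule pick_in_set_inf)
    then have "A $$ (i, pick J j) = Min ((\<lambda>\<tau>. f i \<tau> + g \<tau> (pick J j)) ` {..<k})"
      using assms i pick_lt by blast
    moreover have "(\<lambda>\<tau>. B $$ (i, \<tau>) + C $$ (\<tau>, j)) ` {..<k}
        = (\<lambda>\<tau>. f i \<tau> + g \<tau> (pick J j)) ` {..<k}"
      using i j by (intro image_cong) (auto simp: B_def C_def)
    moreover have "submatrix A UNIV J $$ (i, j) = A $$ (i, pick J j)"
      using i j by (simp add: submatrix_def m_def pick_UNIV)
    ultimately show "submatrix A UNIV J $$ (i, j) = (B \<otimes>\<^sub>t C) $$ (i, j)"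
      using i j by (simp add: tropical_mult_def B_def C_def)
  qed (simp_all add: dims tropical_mult_def B_def C_def)
  then show ?thesis
    unfolding tropical_factorization_def dims
    by (intro exI[of _ B] exI[of _ C] conjI) (simp_all add: B_def C_def)
qed

text \<open>Rows and columns are numbered from 1 here, as in \<open>C_entry\<close>; the lists run over the four
  values of the inner index. The entry \<open>20\<nu> + 21\<close> is large enough for the factor
  to be irrelevant in that column.\<close>

definition left_row :: "nat \<Rightarrow> nat \<Rightarrow> nat \<Rightarrow> real list" where
  "left_row \<nu> \<mu> i =
    (if i \<le> \<nu> + 1 then
       [10 * real i - (if i = \<nu> + 1 then 6 else if i < \<mu> then 7 else 8),
        0, 20 * real i + 1, 20 * real i + 1]
     else
       [[0, 0, 0, 10 * real \<nu> + 8],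
        [5, 0, 0, 11],
        [0, 2, 2, 2],
        [2, 2, 0, 2],
        [2, 2, 2, 0]] ! (i - (\<nu> + 2)))"

definition right_col :: "nat \<Rightarrow> nat \<Rightarrow> nat \<Rightarrow> real list" where
  "right_col \<nu> \<mu> j =
    (if j \<le> \<nu> + 1 then
       [10 * real j - (if \<mu> < j \<and> j \<le> \<nu> then 2 else 3),
        if j = \<nu> + 1 then 20 * real \<nu> + 21 else 20 * real j - 9,
        if \<mu> < j then 10 * real j - 3 else 20 * real \<nu> + 21,
        0]
     else
       [[10 * real \<nu> + 16, 20 * real \<nu> + 21, 0, 0],
        [2, 0, 2, 2],
        [0, 2, 2, 2],
        [2, 2, 0, 2],
        [2, 2, 2, 0]] ! (j - (\<nu> + 2)))"

lemma Min_image_lessThan_4: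
  fixes h :: "nat \<Rightarrow> 'a :: linorder"
  shows "Min (h ` {..<4}) = min (h 0) (min (h 1) (min (h 2) (h 3)))"
proof -
  have "{..<4} = {0, 1, 2, 3 :: nat}" by auto
  then show ?thesis by simp
qed

lemma le_add_6_cases:
  assumes "(i :: nat) \<le> \<nu> + 6"
  obtains "i \<le> \<nu> + 1" | "i = \<nu> + 2" | "i = \<nu> + 3" | "i = \<nu> + 4" | "i = \<nu> + 5" | "i = \<nu> + 6"
  using assms by linarith

lemma C_entry_eq_Min:
  assumes "\<mu> \<in> {1..\<nu> + 1}" "i \<in> {1..\<nu> + 6}" "j \<in> {1..\<nu> + 6}" "j \<noteq> \<mu>"
  shows "C_entry \<nu> i j = Min ((\<lambda>\<tau>. left_row \<nu> \<mu> i ! \<tau> + right_col \<nu> \<mu> j ! \<tau>) ` {..<4})"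
proof (cases "i \<le> \<nu> + 1 \<and> j \<le> \<nu> + 1")
  case True
  then have i: "i \<le> \<nu> + 1" and j: "j \<le> \<nu> + 1" by auto
  have le: "real i \<le> real \<nu> + 1" "real j \<le> real \<nu> + 1" "1 \<le> real i" "1 \<le> real j"
    using i j assms by auto
  consider "j = \<nu> + 1" | "j \<le> \<nu>" "j < \<mu>" | "j \<le> \<nu>" "\<mu> < j"
    using j assms by linarith
  then show ?thesis
  proof cases
    case 1
    \<comment> \<open>So row \<nu> has offset 8 and row \<nu> + 1 offset 6, which yield the
      exceptional 20\<nu> - 1 and 20\<nu> + 11.\<close>
    then have \<mu>: "\<mu> \<le> \<nu>" using assms by auto
    consider "i = \<nu> + 1" | "i = \<nu>" | "i < \<nu>" using i by linarith
    then show ?thesis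
    proof cases
      case 3
      then have "real i + 1 \<le> real \<nu>" by linarith
      then show ?thesis using 1 3 \<mu> le
        by (simp add: C_entry_def left_row_def right_col_def Min_image_lessThan_4 min_def)
    qed (use 1 \<mu> le in \<open>simp_all add: C_entry_def left_row_def right_col_def Min_image_lessThan_4 min_def\<close>)
  next
    case 2
    have "\<mu> \<le> i \<Longrightarrow> real j + 1 \<le> real i" using 2 by linarith
    then show ?thesis using 2 i le
      by (auto simp: C_entry_def left_row_def right_col_def Min_image_lessThan_4 min_def)
  next
    case 3
    \<comment> \<open>The missing column forces a gap of 2. At j = i + 1 the entry would be 20i,
      below the 20i + 1 of the fourth factor.\<close>
    have "i < \<mu> \<Longrightarrow> real i + 2 \<le> real j" using 3 by linarith
    then show ?thesis using 3 i le
      by (auto simp: C_entry_def left_row_def right_col_def Min_image_lessThan_4 min_def)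
  qed
next
  case False
  have le: "1 \<le> real i" "1 \<le> real j" "i \<le> \<nu> + 6" "j \<le> \<nu> + 6"
    using assms by auto
  \<comment> \<open>In row \<nu> + 3 the third factor gives 10j - 3, which stays above 11 only for j
    \<ge> 2.\<close>
  have \<mu>: "\<mu> < j \<Longrightarrow> 2 \<le> real j" using assms by auto
  show ?thesis
    using le(3)
  proof (cases rule: le_add_6_cases)
    case 1
    then have j: "\<not> j \<le> \<nu> + 1" using False by simp
    \<comment> \<open>In column \<nu> + 2 only row \<nu> + 1 uses the first factor, with value
      20\<nu> + 20; rows above it take 20i + 1.\<close>
    from 1 consider "i = \<nu> + 1" | "i \<le> \<nu>" by linarith
    then show ?thesis
    proof cases
      case 1
      from le(4) show ?thesis
        by (cases rule: le_add_6_cases)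
          (use 1 j in \<open>simp_all add: C_entry_def left_row_def right_col_def Min_image_lessThan_4 min_def\<close>)
    next
      case 2
      then have "real i \<le> real \<nu>" by simp
      with le(4) show ?thesis
        by (cases rule: le_add_6_cases)
          (use 2 le(1) j in \<open>auto simp: C_entry_def left_row_def right_col_def Min_image_lessThan_4 min_def\<close>)
    qed
  qed (use le(4) in \<open>cases rule: le_add_6_cases;
      use le \<mu> in \<open>auto simp: C_entry_def left_row_def right_col_def C_block_def Min_image_lessThan_4 min_def\<close>\<close>)+
qed

theorem theorem5p3:
  fixes \<nu> \<mu> :: nat
  assumes "\<nu> > 1"
    and "\<mu> \<in> {1..\<nu> + 1}"
  shows "factor_rank (remove_col \<mu> (C_mat \<nu>)) \<le> 4"
proof (rule factor_rank_le)
  show "tropical_factorization (remove_col \<mu> (C_mat \<nu>)) 4"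
    unfolding remove_col_def
  proof (rule tropical_factorization_submatrix_cols)
    fix i j
    assume "i < dim_row (C_mat \<nu>)" "j < dim_col (C_mat \<nu>)" "j \<in> - {\<mu> - 1}"
    then have "i < \<nu> + 6" "j < \<nu> + 6" "j + 1 \<noteq> \<mu>"
      by (auto simp: C_mat_def)
    then show "C_mat \<nu> $$ (i, j)
        = Min ((\<lambda>\<tau>. left_row \<nu> \<mu> (i + 1) ! \<tau> + right_col \<nu> \<mu> (j + 1) ! \<tau>) ` {..<4})"
      using C_entry_eq_Min[OF assms(2), of "i + 1" "j + 1"] by (simp add: C_mat_def)
  qed
qed simp

end
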